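(* For each $\hat y_1\in Y_1$ and all sufficiently large $U(\hat y_1)\in\mathbb{R}^{n_x}$ and sufficiently small $L(\hat y_1)\in\mathbb{R}^{n_x}$ (that is, there are thresholds $\bar U,\underline L\in\mathbb{R}^{n_x}$ depending on $\hat y_1$ such that the following holds whenever $U(\hat y_1)\ge\bar U$ and $L(\hat y_1)\le\underline L$ entrywise): for every $z\in\{0,1\}^{n_x}$ with $$\hat y_1\in\arg\max_{y_1\in Y_1}\{d_{l1}^\top y_1+\varphi(z,y_1)\},$$ the inequality $$d_\ell^\top y\ge\phi(z)-(\hat\lambda(z,\hat y_1))^\top(x-z),\qquad \hat\lambda(z,\hat y_1):=U(\hat y_1)\odot(\mathbf 1-z)+L(\hat y_1)\odot z,$$ is valid and tight for $d_\ell^\top y\ge\phi(x)$, i.e. $\phi(z)-(\hat\lambda(z,\hat y_1))^\top(x-z)\le\phi(x)$ for all $x\in\{0,1\}^{n_x}$, with equality at $x=z$.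
   Context: The lower-level variable splits as $y=(y_1,y_2)\in Y=Y_1\times Y_2$, where $Y_1\subseteq\mathbb{R}^{n_{y_1}}$ is the domain of the integer lower-level variables and $Y_2\subseteq\mathbb{R}^{n_{y_2}}$; correspondingly $d_\ell=(d_{l1},d_{l2})$ and $B_\ell=[B_{l1},B_{l2}]$, and $A_\ell,h_\ell$ are real data of compatible dimensions. For $x\in\{0,1\}^{n_x}$, $y_1\in Y_1$, $$\varphi(x,y_1)=\max\{d_{l2}^\top y_2 : y_2\in Y_2,\ B_{l2}y_2\le h_\ell-A_\ell x-B_{l1}y_1\}$$ (with value $-\infty$ if infeasible), and $\phi:\{0,1\}^{n_x}\to\mathbb{R}$, $\phi(x)=\max_{y_1\in Y_1}\{d_{l1}^\top y_1+\varphi(x,y_1)\}$, which is real-valued with maxima attained. $\mathbf 1$ is the all-ones vector and $\odot$ the entrywise product. *)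

theory Defs
  imports "HOL-Analysis.Analysis"
begin

definition binary_vecs :: "(real ^ 'n) set" where
  "binary_vecs = {x. \<forall>i. x $ i = 0 \<or> x $ i = 1}"

definition integer_vecs :: "(real ^ 'n) set" where
  "integer_vecs = {y. \<forall>i. y $ i \<in> \<int>}"

(* The order on vectors is entrywise. *)
definition cont_feasible ::
  "real ^ 'n ^ 'k \<Rightarrow> real ^ 'p ^ 'k \<Rightarrow> real ^ 'q ^ 'k \<Rightarrow> real ^ 'k \<Rightarrow> (real ^ 'q) set
    \<Rightarrow> real ^ 'n \<Rightarrow> real ^ 'p \<Rightarrow> (real ^ 'q) set" where
  "cont_feasible A B1 B2 h Y2 x y1 = {y2 \<in> Y2. B2 *v y2 \<le> h - A *v x - B1 *v y1}"

(* Maxima are written as suprema in the extended reals, so the value of an infeasible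
   problem is Sup {} = -\<infinity>; maxima_attained below makes every supremum a maximum. *)
definition cont_value ::
  "real ^ 'q \<Rightarrow> real ^ 'n ^ 'k \<Rightarrow> real ^ 'p ^ 'k \<Rightarrow> real ^ 'q ^ 'k \<Rightarrow> real ^ 'k
    \<Rightarrow> (real ^ 'q) set \<Rightarrow> real ^ 'n \<Rightarrow> real ^ 'p \<Rightarrow> ereal" where
  "cont_value d2 A B1 B2 h Y2 x y1 =
     (SUP y2 \<in> cont_feasible A B1 B2 h Y2 x y1. ereal (d2 \<bullet> y2))"

definition int_objective ::
  "real ^ 'p \<Rightarrow> real ^ 'q \<Rightarrow> real ^ 'n ^ 'k \<Rightarrow> real ^ 'p ^ 'k \<Rightarrow> real ^ 'q ^ 'k \<Rightarrow> real ^ 'k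
    \<Rightarrow> (real ^ 'q) set \<Rightarrow> real ^ 'n \<Rightarrow> real ^ 'p \<Rightarrow> ereal" where
  "int_objective d1 d2 A B1 B2 h Y2 x y1 =
     ereal (d1 \<bullet> y1) + cont_value d2 A B1 B2 h Y2 x y1"

definition ext_value ::
  "real ^ 'p \<Rightarrow> real ^ 'q \<Rightarrow> real ^ 'n ^ 'k \<Rightarrow> real ^ 'p ^ 'k \<Rightarrow> real ^ 'q ^ 'k \<Rightarrow> real ^ 'k
    \<Rightarrow> (real ^ 'p) set \<Rightarrow> (real ^ 'q) set \<Rightarrow> real ^ 'n \<Rightarrow> ereal" where
  "ext_value d1 d2 A B1 B2 h Y1 Y2 x = (SUP y1 \<in> Y1. int_objective d1 d2 A B1 B2 h Y2 x y1)"

(* Only meaningful where ext_value is finite, which the statement assumes on binary_vecs. *)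
definition value_fun ::
  "real ^ 'p \<Rightarrow> real ^ 'q \<Rightarrow> real ^ 'n ^ 'k \<Rightarrow> real ^ 'p ^ 'k \<Rightarrow> real ^ 'q ^ 'k \<Rightarrow> real ^ 'k
    \<Rightarrow> (real ^ 'p) set \<Rightarrow> (real ^ 'q) set \<Rightarrow> real ^ 'n \<Rightarrow> real" where
  "value_fun d1 d2 A B1 B2 h Y1 Y2 x = real_of_ereal (ext_value d1 d2 A B1 B2 h Y1 Y2 x)"

definition maxima_attained ::
  "real ^ 'p \<Rightarrow> real ^ 'q \<Rightarrow> real ^ 'n ^ 'k \<Rightarrow> real ^ 'p ^ 'k \<Rightarrow> real ^ 'q ^ 'k \<Rightarrow> real ^ 'k
    \<Rightarrow> (real ^ 'p) set \<Rightarrow> (real ^ 'q) set \<Rightarrow> bool" where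
  "maxima_attained d1 d2 A B1 B2 h Y1 Y2 \<longleftrightarrow>
     (\<forall>x \<in> binary_vecs.
        (\<exists>y1. is_arg_max (int_objective d1 d2 A B1 B2 h Y2 x) (\<lambda>y. y \<in> Y1) y1) \<and>
        (\<forall>y1 \<in> Y1. cont_feasible A B1 B2 h Y2 x y1 \<noteq> {} \<longrightarrow>
           (\<exists>y2. is_arg_max (\<lambda>y. d2 \<bullet> y) (\<lambda>y. y \<in> cont_feasible A B1 B2 h Y2 x y1) y2)))"

(* On vectors, * is the entrywise product and 1 the all-ones vector. *)
definition cut_coeff :: "real ^ 'n \<Rightarrow> real ^ 'n \<Rightarrow> real ^ 'n \<Rightarrow> real ^ 'n" where
  "cut_coeff U L z = U * (1 - z) + L * z"

end

theory Submission imports Defs begin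

text \<open>Only the finiteness of the hypercube matters: a finite family of real values has bounded
  differences, say by \<open>M \<ge> 0\<close>. If every entry of \<open>U\<close> is at least \<open>M\<close> and every entry of \<open>L\<close>
  at most \<open>-M\<close>, then each coordinate in which \<open>x\<close> and \<open>z\<close> differ contributes at least \<open>M\<close> to
  the penalty term, so a single flipped coordinate already pays for the difference of the values.\<close>

lemma finite_binary_vecs: "finite (binary_vecs :: (real ^ 'n) set)"
\<comment> \<open>Supports inject the binary vectors into the finite power set of the index type: an
  entry different from 1 must be 0, so the support determines the vector.\<close>
proof (rule finite_imageD)
  show "finite ((\<lambda>x :: real ^ 'n. {i. x $ i = 1}) ` binary_vecs)"
    by simp
  show "inj_on (\<lambda>x :: real ^ 'n. {i. x $ i = 1}) binary_vecs"
  proof (rule inj_onI)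
    fix x y :: "real ^ 'n"
    assume x: "x \<in> binary_vecs" and y: "y \<in> binary_vecs"
      and eq: "{i. x $ i = 1} = {i. y $ i = 1}"
    have "x $ i = y $ i" for i
    proof -
      have "x $ i = 1 \<longleftrightarrow> y $ i = 1"
        using eq by blast
      then show ?thesis
        using x y by (auto simp: binary_vecs_def dest!: spec[of _ i])
    qed
    then show "x = y"
      by (simp add: vec_eq_iff)
  qed
qed

text \<open>Each value is bounded in absolute value by the sum of all absolute values. Unlike a
  maximum, this sum also makes sense for empty \<open>S\<close>.\<close>

lemma finite_imp_diff_bounded:
  fixes f :: "'a \<Rightarrow> real"
  assumes "finite S"
  obtains M where "0 \<le> M" and "\<And>x z. x \<in> S \<Longrightarrow> z \<in> S \<Longrightarrow> f z - f x \<le> M"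
proof
  show "0 \<le> 2 * (\<Sum>x\<in>S. \<bar>f x\<bar>)"
    by (simp add: sum_nonneg)
  fix x z assume "x \<in> S" "z \<in> S"
  then have "\<bar>f x\<bar> \<le> (\<Sum>x\<in>S. \<bar>f x\<bar>)" "\<bar>f z\<bar> \<le> (\<Sum>x\<in>S. \<bar>f x\<bar>)"
    using assms by (auto intro: member_le_sum)
  then show "f z - f x \<le> 2 * (\<Sum>x\<in>S. \<bar>f x\<bar>)"
    by linarith
qed

lemma cut_coeff_inner_ge:
  fixes x z U L :: "real ^ 'n"
  assumes x: "x \<in> binary_vecs" and z: "z \<in> binary_vecs" and "x \<noteq> z" and "0 \<le> M"
    and U: "\<And>i. M \<le> U $ i" and L: "\<And>i. L $ i \<le> - M"
  shows "M \<le> cut_coeff U L z \<bullet> (x - z)"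
proof -
  define t where "t i = cut_coeff U L z $ i * (x $ i - z $ i)" for i
  \<comment> \<open>A flip from 0 to 1 contributes \<open>U $ i\<close>, and a flip from 1 to 0
    contributes \<open>- L $ i\<close>; both are at least \<open>M\<close>.\<close>
  have cases: "x $ i = z $ i \<and> t i = 0 \<or> M \<le> t i" for i
  proof -
    have "x $ i = 0 \<or> x $ i = 1" "z $ i = 0 \<or> z $ i = 1"
      using x z by (auto simp: binary_vecs_def)
    moreover have "t i = (U $ i * (1 - z $ i) + L $ i * z $ i) * (x $ i - z $ i)"
      by (simp add: t_def cut_coeff_def)
    ultimately show ?thesis
      using U[of i] L[of i] by (elim disjE) simp_all
  qed
  then have nonneg: "0 \<le> t i" for i
    using cases[of i] \<open>0 \<le> M\<close> by linarith
  obtain j where "x $ j \<noteq> z $ j"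
    using \<open>x \<noteq> z\<close> by (auto simp: vec_eq_iff)
  then have "M \<le> t j"
    using cases by blast
  \<comment> \<open>Since no term is negative, the other coordinates cannot cancel the contribution
    of \<open>j\<close>.\<close>
  also have "t j \<le> sum t UNIV"
    using nonneg by (intro member_le_sum) auto
  also have "sum t UNIV = cut_coeff U L z \<bullet> (x - z)"
    by (simp add: inner_vec_def t_def)
  finally show ?thesis .
qed

theorem proposition9:
  fixes d1 :: "real ^ 'p" and d2 :: "real ^ 'q"
    and A :: "real ^ 'n ^ 'k" and B1 :: "real ^ 'p ^ 'k" and B2 :: "real ^ 'q ^ 'k"
    and h :: "real ^ 'k"
    and Y1 :: "(real ^ 'p) set" and Y2 :: "(real ^ 'q) set"
  assumes integral: "Y1 \<subseteq> integer_vecs"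
    and attained: "maxima_attained d1 d2 A B1 B2 h Y1 Y2"
    and real_valued: "\<forall>x \<in> binary_vecs. \<bar>ext_value d1 d2 A B1 B2 h Y1 Y2 x\<bar> \<noteq> \<infinity>"
  shows "\<forall>yhat \<in> Y1. \<exists>Ubar Lbar :: real ^ 'n.
           \<forall>U L. Ubar \<le> U \<longrightarrow> L \<le> Lbar \<longrightarrow>
             (\<forall>z \<in> binary_vecs.
                is_arg_max (int_objective d1 d2 A B1 B2 h Y2 z) (\<lambda>y. y \<in> Y1) yhat \<longrightarrow>
                (\<forall>x \<in> binary_vecs.
                   value_fun d1 d2 A B1 B2 h Y1 Y2 z - cut_coeff U L z \<bullet> (x - z)
                     \<le> value_fun d1 d2 A B1 B2 h Y1 Y2 x) \<and>
                value_fun d1 d2 A B1 B2 h Y1 Y2 z - cut_coeff U L z \<bullet> (z - z)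
                  = value_fun d1 d2 A B1 B2 h Y1 Y2 z)"
proof (intro ballI)
  fix yhat assume "yhat \<in> Y1"
  let ?f = "value_fun d1 d2 A B1 B2 h Y1 Y2"
  \<comment> \<open>One \<open>M\<close> serves all pairs of binary vectors, so the thresholds can
    be fixed before \<open>z\<close> is chosen.\<close>
  obtain M where M: "0 \<le> M"
    "\<And>x z. x \<in> binary_vecs \<Longrightarrow> z \<in> binary_vecs \<Longrightarrow> ?f z - ?f x \<le> M"
    using finite_imp_diff_bounded[OF finite_binary_vecs] by blast
  have cut: "?f z - cut_coeff U L z \<bullet> (x - z) \<le> ?f x"
    if "(\<chi> i. M) \<le> U" "L \<le> (\<chi> i. - M)" "z \<in> binary_vecs" "x \<in> binary_vecs" for U L x z
  \<comment> \<open>At \<open>x = z\<close> the penalty vanishes and the cut is an equality; the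
    lower bound \<open>M\<close> on the penalty needs a flipped coordinate.\<close>
  proof (cases "x = z")
    case False
    have "M \<le> U $ i" "L $ i \<le> - M" for i
      using that(1,2) by (simp_all add: less_eq_vec_def)
    then have "M \<le> cut_coeff U L z \<bullet> (x - z)"
      using that(3,4) False M(1) by (intro cut_coeff_inner_ge)
    then show ?thesis
      using M(2)[OF that(4,3)] by linarith
  qed simp
  show "\<exists>Ubar Lbar :: real ^ 'n.
           \<forall>U L. Ubar \<le> U \<longrightarrow> L \<le> Lbar \<longrightarrow>
             (\<forall>z \<in> binary_vecs.
                is_arg_max (int_objective d1 d2 A B1 B2 h Y2 z) (\<lambda>y. y \<in> Y1) yhat \<longrightarrow>
                (\<forall>x \<in> binary_vecs. ?f z - cut_coeff U L z \<bullet> (x - z) \<le> ?f x) \<and>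
                ?f z - cut_coeff U L z \<bullet> (z - z) = ?f z)"
    \<comment> \<open>Validity is \<open>cut\<close>; tightness reduces to
      \<open>z - z = 0\<close>.\<close>
    by (rule exI[of _ "\<chi> i. M"], rule exI[of _ "\<chi> i. - M"]) (intro allI impI ballI conjI cut; simp)
qed

end
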